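(* Fix a positive integer $l$. For each integer $n\ge l+1$, let $k_n$ be any integer $k$ with $l\le k\le n-1$ that minimizes $E_n(k,l)$ over all such $k$. Then, as $n\to\infty$, $$k_n\sim n^{l/(l+1)}\qquad\text{and}\qquad E_n(k_n,l)\sim\frac{l+1}{2}\cdot n^{1/(l+1)},$$ where $f(n)\sim g(n)$ means $f(n)/g(n)\to 1$.
   Context: The stopping rule $\mathcal{R}_n(k,l)$ (for positive integers $l\le k\le n-1$) selects an element $s$ of a permutation $a_1,a_2,\dots,a_n$ of $\{1,2,\dots,n\}$ as follows. Let $t$ be the $l$-th lowest value among $a_1,\dots,a_k$, and let $I=\{i\in\{1,\dots,n-k\} : a_{k+i}<t\}$. Let $j=\min I$ if $I\ne\emptyset$ and $j=n-k$ if $I=\emptyset$. The rule selects $s=a_{k+j}$. $E_n(k,l)$ denotes the expected value of $s$ when the permutation is uniformly random among all $n!$ permutations. *)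

theory Defs
  imports
    "HOL-Probability.Probability"
    "HOL-Combinatorics.Permutations"
    "HOL-Library.Landau_Symbols"
begin

text \<open>A permutation $a_1,\dots,a_n$ of $\{1,\dots,n\}$ is a function \<open>a\<close> with \<open>a permutes {1..n}\<close>;
  its entries are \<open>a 1, \<dots>, a n\<close>. The definitions are meant for \<open>1 \<le> l \<le> k \<le> n - 1\<close>.\<close>

text \<open>The index is shifted because \<open>(!)\<close> counts list positions from \<open>0\<close>.\<close>

definition threshold :: "nat \<Rightarrow> nat \<Rightarrow> (nat \<Rightarrow> nat) \<Rightarrow> nat" where
  "threshold k l a = sorted_list_of_set (a ` {1..k}) ! (l - 1)"

definition below_threshold :: "nat \<Rightarrow> nat \<Rightarrow> nat \<Rightarrow> (nat \<Rightarrow> nat) \<Rightarrow> nat set" where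
  "below_threshold n k l a = {i \<in> {1..n - k}. a (k + i) < threshold k l a}"

definition stop_index :: "nat \<Rightarrow> nat \<Rightarrow> nat \<Rightarrow> (nat \<Rightarrow> nat) \<Rightarrow> nat" where
  "stop_index n k l a =
     (if below_threshold n k l a \<noteq> {} then Min (below_threshold n k l a) else n - k)"

definition selected :: "nat \<Rightarrow> nat \<Rightarrow> nat \<Rightarrow> (nat \<Rightarrow> nat) \<Rightarrow> nat" where
  "selected n k l a = a (k + stop_index n k l a)"

definition expected_selected :: "nat \<Rightarrow> nat \<Rightarrow> nat \<Rightarrow> real" where
  "expected_selected n k l =
     measure_pmf.expectation (pmf_of_set {a. a permutes {1..n}}) (\<lambda>a. real (selected n k l a))"

end

theory Submission
  imports Defs
begin

text \<open>Write \<open>t\<close> for the threshold. Given \<open>t > l\<close>, the selected value is symmetric about \<open>t / 2\<close>;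
  given \<open>t = l\<close>, it is the last entry and symmetric about \<open>(n + l + 1) / 2\<close>. The mean of \<open>t\<close> is
  \<open>l (n + 1) / (k + 1)\<close>, and \<open>t = l\<close> means that the values \<open>1, \<dots>, l\<close> all occur among the first \<open>k\<close>
  entries. This gives the exact formula
  \<open>E\<^sub>n(k,l) = (n + 1) / 2 * (l / (k + 1) + (\<Prod>i<l. (k - i) / (n - i)))\<close>.
  With \<open>x = n powr (l / (l + 1))\<close>, so that \<open>x ^ (l + 1) = n ^ l\<close>, and \<open>w \<approx> k / x\<close>, the second factor
  times \<open>x\<close> is approximately \<open>l / w + w ^ l\<close>, whose unique minimum is \<open>l + 1\<close>, at \<open>w = 1\<close>.
  Choosing \<open>k = \<lfloor>x\<rfloor>\<close> bounds the minimum by \<open>l + 1\<close>, and \<open>power_tangent_ge\<close> forces \<open>w \<longlonglongrightarrow> 1\<close>.\<close>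

section \<open>Ranks in finite linear orders\<close>

lemma card_less_nth_sorted_list_of_set:
  fixes S :: "'a::linorder set"
  assumes "finite S" "j < card S"
  shows "card {x \<in> S. x < sorted_list_of_set S ! j} = j"
proof -
  let ?xs = "sorted_list_of_set S"
  have len: "length ?xs = card S" and set: "set ?xs = S" and sorted: "sorted_wrt (<) ?xs"
    using assms by auto
  have "{x \<in> S. x < ?xs ! j} = (!) ?xs ` {..<j}"
  proof (intro equalityI subsetI)
    fix x assume "x \<in> {x \<in> S. x < ?xs ! j}"
    then have "x \<in> set ?xs" and less: "x < ?xs ! j"
      using set by simp_all
    then obtain i where i: "i < card S" "x = ?xs ! i"
      using len by (metis in_set_conv_nth)
    with less have "i < j"
      using sorted_wrt_nth_less[OF sorted, of j i] len by (metis linorder_neqE_nat order_less_asym)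
    then show "x \<in> (!) ?xs ` {..<j}"
      using i by auto
  next
    fix x assume "x \<in> (!) ?xs ` {..<j}"
    then obtain i where "i < j" "x = ?xs ! i" by auto
    then show "x \<in> {x \<in> S. x < ?xs ! j}"
      using sorted_wrt_nth_less[OF sorted, of i j] nth_mem[of i ?xs] len set assms(2) by simp
  qed
  moreover have "inj_on ((!) ?xs) {..<j}"
    using assms(2) len by (intro inj_on_nth) auto
  ultimately show ?thesis
    by (simp add: card_image)
qed

text \<open>If \<open>y\<close> exceeds the member \<open>t\<close>, the count for \<open>y\<close>
  gains \<open>t\<close> itself. The point \<open>y\<close> is arbitrary, so that it can later be an
  entry from outside the first \<open>k\<close>.\<close>

lemma card_less_iff_less:
  fixes S :: "'a::linorder set"
  assumes "finite S" "t \<in> S"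
  shows "card {x \<in> S. x < y} \<le> card {x \<in> S. x < t} \<longleftrightarrow> y \<le> t"
proof
  assume "y \<le> t"
  then show "card {x \<in> S. x < y} \<le> card {x \<in> S. x < t}"
    using assms(1) by (intro card_mono) auto
next
  assume le: "card {x \<in> S. x < y} \<le> card {x \<in> S. x < t}"
  show "y \<le> t"
  proof (rule ccontr)
    assume "\<not> y \<le> t"
    then have "{x \<in> S. x < t} \<subset> {x \<in> S. x < y}"
      using assms(2) by force
    then have "card {x \<in> S. x < t} < card {x \<in> S. x < y}"
      using assms(1) by (intro psubset_card_mono) auto
    with le show False by simp
  qed
qed

section \<open>Reversing an interval of values\<close>

text \<open>The open interval keeps both endpoints fixed, so a threshold used as an endpoint stays
  in place. A moved value and its image add up to \<open>p + q\<close>.\<close>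

definition reverse_between :: "nat \<Rightarrow> nat \<Rightarrow> nat \<Rightarrow> nat" where
  "reverse_between p q x = (if p < x \<and> x < q then p + q - x else x)"

lemma reverse_between_involution [simp]: "reverse_between p q (reverse_between p q x) = x"
  by (auto simp: reverse_between_def)

lemma reverse_between_permutes:
  assumes "q \<le> Suc n"
  shows "reverse_between p q permutes {1..n}"
  unfolding permutes_def
proof (intro conjI allI impI)
  fix y show "\<exists>!x. reverse_between p q x = y"
    by (metis reverse_between_involution)
qed (use assms in \<open>auto simp: reverse_between_def\<close>)

section \<open>The threshold and its rank\<close>

context
  fixes n k l :: nat
  assumes l_pos: "1 \<le> l" and l_le_k: "l \<le> k" and k_less_n: "k < n"
begin

lemma card_first_values:
  assumes "a permutes {1..n}"
  shows "card (a ` {1..k}) = k"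
  using card_image[OF inj_on_subset[OF permutes_inj[OF assms]], of "{1..k}"] by simp

text \<open>The bounds \<open>1 \<le> l \<le> k\<close> make \<open>l - 1\<close> a valid list
  index. Together with \<open>threshold_eqI\<close> these facts characterise the threshold, and its
  list definition is not unfolded again.\<close>

lemma
  assumes "a permutes {1..n}"
  shows threshold_mem: "threshold k l a \<in> a ` {1..k}"
    and card_less_threshold: "card {x \<in> a ` {1..k}. x < threshold k l a} = l - 1"
proof -
  have "l - 1 < card (a ` {1..k})"
    using card_first_values[OF assms] l_pos l_le_k by simp
  then show "threshold k l a \<in> a ` {1..k}"
    "card {x \<in> a ` {1..k}. x < threshold k l a} = l - 1"
    using card_less_nth_sorted_list_of_set[of "a ` {1..k}" "l - 1"]
      nth_mem[of "l - 1" "sorted_list_of_set (a ` {1..k})"]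
    unfolding threshold_def by auto
qed

text \<open>Two members of equal rank bound each other by \<open>card_less_iff_less\<close>, so the
  rank determines the member.\<close>

lemma threshold_eqI:
  assumes "a permutes {1..n}" "v \<in> a ` {1..k}" "card {x \<in> a ` {1..k}. x < v} = l - 1"
  shows "threshold k l a = v"
  using card_less_iff_less[of "a ` {1..k}" v "threshold k l a"]
    card_less_iff_less[of "a ` {1..k}" "threshold k l a" v]
    assms threshold_mem card_less_threshold by (simp add: order_antisym)

lemma first_values_subset:
  assumes "a permutes {1..n}"
  shows "a ` {1..k} \<subseteq> {1..n}"
  using permutes_image[OF assms] k_less_n image_mono[of "{1..k}" "{1..n}" a] by auto

lemma threshold_bounds:
  assumes "a permutes {1..n}"
  shows "l \<le> threshold k l a" "threshold k l a \<le> n"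
proof -
  note sub = first_values_subset[OF assms]
  then show "threshold k l a \<le> n"
    using threshold_mem[OF assms] by auto
  have "{x \<in> a ` {1..k}. x < threshold k l a} \<subseteq> {1..<threshold k l a}"
    using sub by auto
  then have "l - 1 \<le> threshold k l a - 1"
    using card_mono[OF finite_atLeastLessThan] card_less_threshold[OF assms]
    by (metis card_atLeastLessThan)
  moreover have "1 \<le> threshold k l a"
    using sub threshold_mem[OF assms] by auto
  ultimately show "l \<le> threshold k l a"
    by simp
qed

text \<open>The \<open>t - 1\<close> values below the threshold \<open>t\<close> sit at
  \<open>l - 1\<close> of the first \<open>k\<close> positions and at the counted later ones. This
  reduces the mean of \<open>t\<close> to one probability per later position.\<close>

lemma threshold_eq_card:
  assumes "a permutes {1..n}"
  shows "threshold k l a = l + card {i \<in> {k<..n}. a i < threshold k l a}"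
proof -
  let ?t = "threshold k l a"
  have inj: "inj a" using assms by (rule permutes_inj)
  have "a ` {i \<in> {1..n}. a i < ?t} = {x \<in> a ` {1..n}. x < ?t}"
    by auto
  also have "\<dots> = {1..<?t}"
    using permutes_image[OF assms] threshold_bounds(2)[OF assms] by auto
  finally have "a ` {i \<in> {1..n}. a i < ?t} = {1..<?t}" .
  then have "?t - 1 = card {i \<in> {1..n}. a i < ?t}"
    using card_image[OF inj_on_subset[OF inj], of "{i \<in> {1..n}. a i < ?t}"] by simp
  also have "{i \<in> {1..n}. a i < ?t} = {i \<in> {1..k}. a i < ?t} \<union> {i \<in> {k<..n}. a i < ?t}"
    using k_less_n by auto
  also have "card \<dots> = card {i \<in> {1..k}. a i < ?t} + card {i \<in> {k<..n}. a i < ?t}"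
    by (rule card_Un_disjoint) auto
  also have "card {i \<in> {1..k}. a i < ?t} = card (a ` {i \<in> {1..k}. a i < ?t})"
    by (rule card_image[symmetric], rule inj_on_subset[OF inj]) auto
  also have "a ` {i \<in> {1..k}. a i < ?t} = {x \<in> a ` {1..k}. x < ?t}"
    by auto
  finally show ?thesis
    using card_less_threshold[OF assms] threshold_bounds(1)[OF assms] l_pos by simp
qed

text \<open>Exactly \<open>l - 1\<close> of the first \<open>k\<close> entries lie below the
  threshold; if it equals \<open>l\<close>, they must be all of
  \<open>1, ..., l - 1\<close>.\<close>

lemma threshold_eq_l_iff:
  assumes "a permutes {1..n}"
  shows "threshold k l a = l \<longleftrightarrow> {1..l} \<subseteq> a ` {1..k}"
proof
  assume t: "threshold k l a = l"
  have pos: "0 < x" if "x \<in> a ` {1..k}" for x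
    using that first_values_subset[OF assms] by auto
  have "{x \<in> a ` {1..k}. x < l} = {1..<l}"
    using card_less_threshold[OF assms] t pos by (intro card_subset_eq) force+
  moreover have "l \<in> a ` {1..k}"
    using threshold_mem[OF assms] t by simp
  moreover have "{1..l} = insert l {1..<l}"
    using l_pos by auto
  ultimately show "{1..l} \<subseteq> a ` {1..k}"
    by blast
next
  assume sub: "{1..l} \<subseteq> a ` {1..k}"
  have pos: "0 < x" if "x \<in> a ` {1..k}" for x
    using that first_values_subset[OF assms] by auto
  have "{x \<in> a ` {1..k}. x < l} = {1..<l}"
    using sub pos by force
  then show "threshold k l a = l"
    using sub l_pos by (intro threshold_eqI[OF assms]) auto
qed

section \<open>Symmetry of the selected value\<close>

text \<open>Relabelling by \<open>s\<close> keeps every comparison with the threshold, so the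
  stopping position stays and only the value found there is relabelled.\<close>

lemma selected_comp:
  assumes a: "a permutes {1..n}" and s: "s permutes {1..n}"
    and fix_t: "s (threshold k l a) = threshold k l a"
    and less_iff: "\<And>x. s x < threshold k l a \<longleftrightarrow> x < threshold k l a"
  shows "threshold k l (s \<circ> a) = threshold k l a" "selected n k l (s \<circ> a) = s (selected n k l a)"
proof -
  let ?t = "threshold k l a"
  have "{x \<in> (s \<circ> a) ` {1..k}. x < ?t} = s ` {x \<in> a ` {1..k}. x < ?t}"
    using less_iff by auto
  then have "card {x \<in> (s \<circ> a) ` {1..k}. x < ?t} = l - 1"
    using card_less_threshold[OF a] card_image[OF inj_on_subset[OF permutes_inj[OF s]]] by simp
  moreover have "?t \<in> (s \<circ> a) ` {1..k}"
    using threshold_mem[OF a] fix_t by (metis image_comp imageI)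
  ultimately show t: "threshold k l (s \<circ> a) = ?t"
    by (intro threshold_eqI permutes_compose a s)
  have "below_threshold n k l (s \<circ> a) = below_threshold n k l a"
    unfolding below_threshold_def t using less_iff by simp
  then show "selected n k l (s \<circ> a) = s (selected n k l a)"
    unfolding selected_def stop_index_def by simp
qed

text \<open>By \<open>threshold_eq_card\<close>, a threshold above \<open>l\<close> forces a smaller
  entry after position \<open>k\<close>, so the rule does not stop by default.\<close>

lemma selected_less_threshold:
  assumes a: "a permutes {1..n}" and "l < threshold k l a"
  shows "0 < selected n k l a" "selected n k l a < threshold k l a"
proof -
  let ?t = "threshold k l a" and ?B = "below_threshold n k l a"
  have "card {i \<in> {k<..n}. a i < ?t} \<noteq> 0"
    using threshold_eq_card[OF a] assms(2) by linarith
  then obtain i where i: "k < i" "i \<le> n" "a i < ?t"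
    by (metis (no_types, lifting) Collect_empty_eq card.empty greaterThanAtMost_iff)
  then have "i - k \<in> ?B"
    by (auto simp: below_threshold_def)
  then have ne: "?B \<noteq> {}" by auto
  have "finite ?B" by (simp add: below_threshold_def)
  from Min_in[OF this ne] ne have "stop_index n k l a \<in> ?B"
    by (simp add: stop_index_def)
  then have *: "stop_index n k l a \<le> n - k" "1 \<le> stop_index n k l a" "selected n k l a < ?t"
    by (auto simp: below_threshold_def selected_def)
  then show "selected n k l a < ?t" by simp
  have "k + stop_index n k l a \<in> {1..n}"
    using * k_less_n by auto
  then have "selected n k l a \<in> {1..n}"
    unfolding selected_def using permutes_in_image[OF a] by blast
  then show "0 < selected n k l a" by simp
qed

text \<open>The first \<open>k\<close> entries use up the values \<open>1, ..., l\<close>, so no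
  later entry is below the threshold and the default index \<open>n - k\<close> leads to position
  \<open>n\<close>.\<close>

lemma selected_eq_last:
  assumes a: "a permutes {1..n}" and t: "threshold k l a = l"
  shows "l < selected n k l a" "selected n k l a \<le> n"
proof -
  have not_first: "a i \<notin> a ` {1..k}" if "k < i" for i
    using that inj_image_mem_iff[OF permutes_inj[OF a]] by simp
  have gt: "l < a i" if "k < i" "i \<le> n" for i
  proof -
    have "a i \<notin> {1..l}"
      using not_first[OF that(1)] threshold_eq_l_iff[OF a] t by blast
    moreover have "a i \<in> {1..n}"
      using permutes_in_image[OF a] that by auto
    ultimately show ?thesis by auto
  qed
  then have "below_threshold n k l a = {}"
    unfolding below_threshold_def t using k_less_n
    by (auto simp: not_less intro!: less_imp_le)
  then have "selected n k l a = a n"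
    using k_less_n by (simp add: selected_def stop_index_def)
  moreover have "a n \<in> {1..n}"
    using permutes_in_image[OF a] k_less_n by auto
  ultimately show "l < selected n k l a" "selected n k l a \<le> n"
    using gt k_less_n by auto
qed

text \<open>The rule only compares values with the threshold \<open>t\<close>, so reversing the order of the values
  below \<open>t\<close> (if \<open>t > l\<close>), or of those above \<open>t\<close> (if \<open>t = l\<close>), stops at the same position.\<close>

lemma sum_selected:
  "2 * (\<Sum>a | a permutes {1..n}. selected n k l a) =
     (\<Sum>a | a permutes {1..n}. threshold k l a)
     + (n + 1) * card {a. a permutes {1..n} \<and> threshold k l a = l}"
proof -
  let ?P = "{a. a permutes {1..n}}"
  \<comment> \<open>As endpoints are excluded, the reversed block is \<open>l + 1, ..., n\<close> in
    the first case and \<open>1, ..., t - 1\<close> for a threshold \<open>t > l\<close>.\<close>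
  define r where "r a = (if threshold k l a = l then reverse_between l (Suc n)
    else reverse_between 0 (threshold k l a))" for a
  define \<phi> where "\<phi> a = r a \<circ> a" for a
  have r_perm: "r a permutes {1..n}" if "a permutes {1..n}" for a
    using threshold_bounds[OF that]
    unfolding r_def by (simp add: reverse_between_permutes del: One_nat_def)
  have comp: "threshold k l (\<phi> a) = threshold k l a" "selected n k l (\<phi> a) = r a (selected n k l a)"
    if "a permutes {1..n}" for a
  proof -
    have fixed: "r a (threshold k l a) = threshold k l a"
      "r a x < threshold k l a \<longleftrightarrow> x < threshold k l a" for x
      by (auto simp: r_def reverse_between_def)
    show "threshold k l (\<phi> a) = threshold k l a" "selected n k l (\<phi> a) = r a (selected n k l a)"
      unfolding \<phi>_def
      using selected_comp[OF that r_perm[OF that] fixed] by auto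
  qed
  have \<phi>_perm: "\<phi> a permutes {1..n}" if "a permutes {1..n}" for a
    unfolding \<phi>_def using that r_perm by (intro permutes_compose)
  have \<phi>_\<phi>: "\<phi> (\<phi> a) = a" if "a permutes {1..n}" for a
  proof -
    \<comment> \<open>The reversal depends on the permutation only through the threshold, which
      \<open>\<phi>\<close> preserves; hence \<open>\<phi>\<close> is an involution.\<close>
    have "r (\<phi> a) = r a"
      using comp(1)[OF that] by (simp add: r_def)
    then have "\<phi> (\<phi> a) = r a \<circ> (r a \<circ> a)"
      by (metis \<phi>_def)
    also have "\<dots> = a"
      by (auto simp: r_def fun_eq_iff)
    finally show ?thesis .
  qed
  have "(\<Sum>a\<in>?P. selected n k l a) = (\<Sum>a\<in>?P. selected n k l (\<phi> a))"
    by (rule sum.reindex_bij_witness[where i = \<phi> and j = \<phi>]) (auto simp: \<phi>_perm \<phi>_\<phi> simp del: One_nat_def)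
  then have "2 * (\<Sum>a\<in>?P. selected n k l a)
      = (\<Sum>a\<in>?P. selected n k l a + selected n k l (\<phi> a))"
    by (simp add: sum.distrib)
  \<comment> \<open>A selected value and its mirror image sum to the threshold \<open>t\<close> if
    \<open>t > l\<close>, and to \<open>l + n + 1 = t + (n + 1)\<close> if
    \<open>t = l\<close>.\<close>
  also have "\<dots> = (\<Sum>a\<in>?P. threshold k l a + (if threshold k l a = l then n + 1 else 0))"
  proof (rule sum.cong)
    fix a assume "a \<in> ?P"
    then have a: "a permutes {1..n}" by simp
    show "selected n k l a + selected n k l (\<phi> a)
        = threshold k l a + (if threshold k l a = l then n + 1 else 0)"
    proof (cases "threshold k l a = l")
      case True
      then show ?thesis
        using selected_eq_last[OF a True] comp(2)[OF a]
        by (simp add: r_def reverse_between_def)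
    next
      case False
      then have "l < threshold k l a"
        using threshold_bounds(1)[OF a] by simp
      then show ?thesis
        using selected_less_threshold[OF a] comp(2)[OF a] False
        by (simp add: r_def reverse_between_def)
    qed
  qed simp
  also have "\<dots> = (\<Sum>a\<in>?P. threshold k l a)
      + (\<Sum>a\<in>?P. if threshold k l a = l then n + 1 else 0)"
    by (rule sum.distrib)
  also have "(\<Sum>a\<in>?P. if threshold k l a = l then n + 1 else 0)
      = (n + 1) * card {a. a permutes {1..n} \<and> threshold k l a = l}"
    by (simp add: finite_permutations flip: sum.inter_filter)
  finally show ?thesis .
qed

section \<open>The mean of the threshold\<close>

text \<open>By exchanging positions, the entry at position \<open>i\<close> is equally likely to have any rank
  among the \<open>k + 1\<close> entries at the positions \<open>1, \<dots>, k, i\<close>.\<close>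

lemma card_less_threshold_at:
  assumes i: "k < i" "i \<le> n"
  shows "(k + 1) * card {a. a permutes {1..n} \<and> a i < threshold k l a} = l * fact n"
proof -
  let ?P = "{a. a permutes {1..n}}"
  define S where "S = insert i {1..k}"
  define N where "N p = {a \<in> ?P. card {q \<in> S. a q < a p} < l}" for p
  have fin: "finite ?P" by (simp add: finite_permutations)
  have S: "finite S" "card S = k + 1" "S \<subseteq> {1..n}"
    using i k_less_n by (auto simp: S_def)
  \<comment> \<open>Position \<open>i\<close> never counts against itself, so the rank may be taken
    in \<open>S\<close>, where all positions play the same role.\<close>
  have "a i < threshold k l a \<longleftrightarrow> card {q \<in> S. a q < a i} < l" if a: "a permutes {1..n}" for a
  proof -
    let ?t = "threshold k l a"
    have inj: "inj a" using a by (rule permutes_inj)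
    have "?t \<noteq> a i"
      using threshold_mem[OF a] i inj_image_mem_iff[OF inj, of i "{1..k}"]
      by auto
    then have "a i < ?t \<longleftrightarrow> a i \<le> ?t" by auto
    also have "\<dots> \<longleftrightarrow> card {x \<in> a ` {1..k}. x < a i} \<le> l - 1"
      using card_less_iff_less[of "a ` {1..k}" ?t "a i"] threshold_mem[OF a]
        card_less_threshold[OF a] by simp
    also have "{x \<in> a ` {1..k}. x < a i} = a ` {q \<in> S. a q < a i}"
      by (auto simp: S_def)
    also have "card (a ` {q \<in> S. a q < a i}) = card {q \<in> S. a q < a i}"
      by (rule card_image[OF inj_on_subset[OF inj]]) simp
    finally show ?thesis using l_pos by auto
  qed
  then have N_i: "{a. a permutes {1..n} \<and> a i < threshold k l a} = N i"
    unfolding N_def by auto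
  \<comment> \<open>Swapping the positions \<open>p\<close> and \<open>i\<close> permutes
    \<open>S\<close> and so carries ranks within \<open>S\<close> along.\<close>
  have N_eq: "card (N p) = card (N i)" if p: "p \<in> S" for p
  proof -
    let ?\<tau> = "Transposition.transpose p i"
    have \<tau>: "?\<tau> permutes {1..n}" "?\<tau> permutes S"
      using p S by (auto simp: S_def intro!: permutes_swap_id)
    have card_eq: "card {q \<in> S. a (?\<tau> q) < y} = card {q \<in> S. a q < y}" for a :: "nat \<Rightarrow> nat" and y
    proof (rule bij_betw_same_card)
      show "bij_betw ?\<tau> {q \<in> S. a (?\<tau> q) < y} {q \<in> S. a q < y}"
        by (rule bij_betwI[where g = ?\<tau>]) (use permutes_in_image[OF \<tau>(2)] in auto)
    qed
    show ?thesis
    proof (rule bij_betw_same_card)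
      show "bij_betw (\<lambda>a. a \<circ> ?\<tau>) (N p) (N i)"
        by (rule bij_betwI[where g = "\<lambda>a. a \<circ> ?\<tau>"])
          (auto simp: N_def card_eq fun_eq_iff permutes_compose[OF \<tau>(1)] simp del: One_nat_def)
    qed
  qed
  have count: "card {p \<in> S. card {q \<in> S. a q < a p} < l} = l" if a: "a permutes {1..n}" for a
  proof -
    have inj: "inj a" using a by (rule permutes_inj)
    \<comment> \<open>The zero-based index \<open>l\<close> gives the entry with exactly
      \<open>l\<close> smaller ones; it exists because \<open>S\<close> has \<open>k + 1 > l\<close>
      positions.\<close>
    let ?T = "a ` S" and ?u = "sorted_list_of_set (a ` S) ! l"
    have T: "finite ?T" "card ?T = k + 1"
      using S card_image[OF inj_on_subset[OF inj], of S] by auto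
    then have u: "card {x \<in> ?T. x < ?u} = l" "?u \<in> ?T"
      using l_le_k card_less_nth_sorted_list_of_set[of ?T l] nth_mem[of l "sorted_list_of_set ?T"]
      by auto
    have "card {q \<in> S. a q < a p} < l \<longleftrightarrow> a p < ?u" if "p \<in> S" for p
    proof -
      have "card {q \<in> S. a q < a p} = card (a ` {q \<in> S. a q < a p})"
        by (rule card_image[OF inj_on_subset[OF inj], symmetric]) simp
      also have "a ` {q \<in> S. a q < a p} = {x \<in> ?T. x < a p}"
        by auto
      finally show ?thesis
        using card_less_iff_less[OF T(1), of "a p" ?u] that u(1) by (simp flip: not_le)
    qed
    then have "{p \<in> S. card {q \<in> S. a q < a p} < l} = {p \<in> S. a p < ?u}"
      by auto
    moreover have "card {p \<in> S. a p < ?u} = card (a ` {p \<in> S. a p < ?u})"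
      by (rule card_image[OF inj_on_subset[OF inj], symmetric]) simp
    moreover have "a ` {p \<in> S. a p < ?u} = {x \<in> ?T. x < ?u}"
      by auto
    ultimately show ?thesis using u by simp
  qed
  have "(k + 1) * card (N i) = (\<Sum>p\<in>S. card (N p))"
    using N_eq S by simp
  also have "\<dots> = (\<Sum>p\<in>S. \<Sum>a\<in>?P. if card {q \<in> S. a q < a p} < l then 1 else 0)"
    using fin by (simp add: N_def flip: sum.inter_filter)
  also have "\<dots> = (\<Sum>a\<in>?P. \<Sum>p\<in>S. if card {q \<in> S. a q < a p} < l then 1 else 0)"
    by (rule sum.swap)
  also have "\<dots> = (\<Sum>a\<in>?P. l)"
    using S count by (intro sum.cong) (auto simp flip: sum.inter_filter)
  also have "\<dots> = l * fact n"
    using card_permutations[of "{1..n}" n] by simp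
  finally show ?thesis unfolding N_i .
qed

text \<open>By \<open>threshold_eq_card\<close> and \<open>card_less_threshold_at\<close> the mean
  is \<open>l + (n - k) * l / (k + 1) = l * (n + 1) / (k + 1)\<close>, written here without
  division.\<close>

lemma sum_threshold:
  "(k + 1) * (\<Sum>a | a permutes {1..n}. threshold k l a) = l * (n + 1) * fact n"
proof -
  let ?P = "{a. a permutes {1..n}}"
  have fin: "finite ?P" by (simp add: finite_permutations)
  have "(\<Sum>a\<in>?P. threshold k l a)
      = (\<Sum>a\<in>?P. l + (\<Sum>i\<in>{k<..n}. if a i < threshold k l a then 1 else 0))"
    using threshold_eq_card
    by (intro sum.cong) (auto simp flip: sum.inter_filter)
  also have "\<dots> = l * fact n + (\<Sum>a\<in>?P. \<Sum>i\<in>{k<..n}. if a i < threshold k l a then 1 else 0)"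
    using card_permutations[of "{1..n}" n] by (simp add: sum.distrib)
  also have "(\<Sum>a\<in>?P. \<Sum>i\<in>{k<..n}. if a i < threshold k l a then 1 else 0)
      = (\<Sum>i\<in>{k<..n}. \<Sum>a\<in>?P. if a i < threshold k l a then 1 else 0)"
    by (rule sum.swap)
  also have "\<dots> = (\<Sum>i\<in>{k<..n}. card {a. a permutes {1..n} \<and> a i < threshold k l a})"
    using fin by (simp flip: sum.inter_filter)
  finally have "(k + 1) * (\<Sum>a\<in>?P. threshold k l a)
      = (k + 1) * l * fact n
        + (\<Sum>i\<in>{k<..n}. (k + 1) * card {a. a permutes {1..n} \<and> a i < threshold k l a})"
    by (simp add: algebra_simps sum_distrib_left)
  also have "\<dots> = (k + 1) * l * fact n + (\<Sum>i\<in>{k<..n}. l * fact n)"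
    using card_less_threshold_at by (intro arg_cong2[where f = "(+)"] sum.cong) auto
  also have "\<dots> = (k + 1 + (n - k)) * l * fact n"
    by (simp add: algebra_simps)
  finally show ?thesis using k_less_n by (simp add: algebra_simps)
qed

end

section \<open>Probability that the smallest values all come early\<close>

text \<open>Once \<open>1, ..., m\<close> occur among the first \<open>k\<close> entries, the other
  \<open>k - m\<close> early places are shared symmetrically by \<open>n - m\<close> values, so
  \<open>m + 1\<close> gets one with probability \<open>(k - m) / (n - m)\<close>.\<close>

lemma card_permutes_initial_subset:
  assumes "m \<le> k" "k \<le> n"
  shows "real (card {a. a permutes {1..n} \<and> {1..m} \<subseteq> a ` {1..k}})
    = fact n * (\<Prod>i<m. (real k - real i) / (real n - real i))"
  using assms(1)
proof (induction m)
  case 0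
  then show ?case using card_permutations[of "{1..n}" n] by simp
next
  case (Suc m)
  define C where "C = {a. a permutes {1..n} \<and> {1..m} \<subseteq> a ` {1..k}}"
  have fin: "finite C"
    unfolding C_def by (rule finite_subset[OF _ finite_permutations[of "{1..n}"]]) auto
  define D where "D x = {a \<in> C. x \<in> a ` {1..k}}" for x
  \<comment> \<open>Exchanging the values \<open>x\<close> and \<open>m + 1\<close> leaves
    \<open>1, ..., m\<close> untouched.\<close>
  have D_eq: "card (D x) = card (D (Suc m))" if x: "x \<in> {m<..n}" for x
  proof -
    let ?\<tau> = "Transposition.transpose x (Suc m)"
    have \<tau>: "?\<tau> permutes {1..n}"
      using x by (intro permutes_swap_id) auto
    have \<tau>_image: "{1..m} \<subseteq> (?\<tau> \<circ> a) ` {1..k}" if "{1..m} \<subseteq> a ` {1..k}" for a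
    proof
      fix y assume y: "y \<in> {1..m}"
      then obtain z where z: "z \<in> {1..k}" "y = a z" using \<open>{1..m} \<subseteq> a ` {1..k}\<close> by blast
      have "?\<tau> y = y" using y x by (simp add: Transposition.transpose_def)
      then show "y \<in> (?\<tau> \<circ> a) ` {1..k}"
        using z by (metis comp_apply imageI)
    qed
    have \<tau>_D: "(\<lambda>a. ?\<tau> \<circ> a) ` D u \<subseteq> D (?\<tau> u)" for u
    proof
      fix b assume "b \<in> (\<lambda>a. ?\<tau> \<circ> a) ` D u"
      then obtain a where a: "b = ?\<tau> \<circ> a" "a permutes {1..n}" "{1..m} \<subseteq> a ` {1..k}" "u \<in> a ` {1..k}"
        by (auto simp: D_def C_def simp del: One_nat_def)
      then have "?\<tau> u \<in> b ` {1..k}"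
        by (metis image_comp imageI)
      then show "b \<in> D (?\<tau> u)"
        unfolding D_def C_def a(1) using \<tau>_image[OF a(3)] permutes_compose[OF a(2) \<tau>] by blast
    qed
    show ?thesis
    proof (rule bij_betw_same_card)
      show "bij_betw (\<lambda>a. ?\<tau> \<circ> a) (D x) (D (Suc m))"
        by (rule bij_betwI[where g = "\<lambda>a. ?\<tau> \<circ> a"])
          (use \<tau>_D[of x] \<tau>_D[of "Suc m"] in \<open>auto simp: fun_eq_iff\<close>)
    qed
  qed
  have count: "card {x \<in> {m<..n}. x \<in> a ` {1..k}} = k - m" if "a \<in> C" for a
  proof -
    have a: "a permutes {1..n}" "{1..m} \<subseteq> a ` {1..k}"
      using that by (auto simp: C_def)
    have "a ` {1..k} \<subseteq> {1..n}"
      using permutes_image[OF a(1)] assms image_mono[of "{1..k}" "{1..n}" a] by auto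
    then have "{x \<in> {m<..n}. x \<in> a ` {1..k}} = a ` {1..k} - {1..m}"
      by fastforce
    moreover have "card (a ` {1..k}) = k"
      using card_image[OF inj_on_subset[OF permutes_inj[OF a(1)]], of "{1..k}"] by simp
    ultimately show ?thesis
      using a(2) by (simp add: card_Diff_subset)
  qed
  \<comment> \<open>Double counting of pairs of a permutation in \<open>C\<close> and a value above
    \<open>m\<close> among its first \<open>k\<close> entries.\<close>
  have "(n - m) * card (D (Suc m)) = (\<Sum>x\<in>{m<..n}. card (D x))"
    using sum.cong[OF refl D_eq, of "{m<..n}" "\<lambda>x. x"] by simp
  also have "\<dots> = (\<Sum>x\<in>{m<..n}. \<Sum>a\<in>C. if x \<in> a ` {1..k} then 1 else 0)"
    using fin by (simp add: D_def flip: sum.inter_filter)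
  also have "\<dots> = (\<Sum>a\<in>C. \<Sum>x\<in>{m<..n}. if x \<in> a ` {1..k} then 1 else 0)"
    by (rule sum.swap)
  also have "\<dots> = (\<Sum>a\<in>C. k - m)"
    using count by (intro sum.cong) (auto simp flip: sum.inter_filter)
  also have "\<dots> = (k - m) * card C" by simp
  finally have "real (n - m) * real (card (D (Suc m))) = real (k - m) * real (card C)"
    by (metis of_nat_mult)
  moreover have "D (Suc m) = {a. a permutes {1..n} \<and> {1..Suc m} \<subseteq> a ` {1..k}}"
    by (auto simp: D_def C_def atLeastAtMostSuc_conv)
  ultimately show ?case
    using Suc assms by (simp add: C_def of_nat_diff field_simps)
qed

section \<open>Exact formula for the expectation\<close>

text \<open>Dividing \<open>sum_selected\<close> by \<open>2 * fact n\<close> leaves half the mean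
  threshold plus \<open>(n + 1) / 2\<close> times the probability that the threshold is
  \<open>l\<close>.\<close>

lemma expected_selected_eq:
  assumes "1 \<le> l" "l \<le> k" "k < n"
  shows "expected_selected n k l = real (n + 1) / 2 *
    (real l / real (k + 1) + (\<Prod>i<l. (real k - real i) / (real n - real i)))"
proof -
  let ?P = "{a. a permutes {1..n}}"
  let ?\<Pi> = "\<Prod>i<l. (real k - real i) / (real n - real i)"
  have "id \<in> ?P"
    by (simp add: permutes_id)
  then have P: "?P \<noteq> {}" by blast
  have fin: "finite ?P" and card: "card ?P = fact n"
    using card_permutations[of "{1..n}" n] by (simp_all add: finite_permutations)
  have "{a. a permutes {1..n} \<and> threshold k l a = l}
      = {a. a permutes {1..n} \<and> {1..l} \<subseteq> a ` {1..k}}"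
    using threshold_eq_l_iff[OF assms] by auto
  then have t_eq: "real (card {a. a permutes {1..n} \<and> threshold k l a = l}) = fact n * ?\<Pi>"
    using card_permutes_initial_subset[of l k n] assms by simp
  have "real ((k + 1) * (\<Sum>a\<in>?P. threshold k l a)) = real (l * (n + 1) * fact n)"
    by (simp only: sum_threshold[OF assms])
  then have sum_t: "real (\<Sum>a\<in>?P. threshold k l a)
      = real l * (real n + 1) * fact n / (real k + 1)"
    by (simp add: field_simps)
  have "2 * real (\<Sum>a\<in>?P. selected n k l a) = real (2 * (\<Sum>a\<in>?P. selected n k l a))"
    by simp
  also have "\<dots> = real (\<Sum>a\<in>?P. threshold k l a)
      + (real n + 1) * real (card {a. a permutes {1..n} \<and> threshold k l a = l})"
    unfolding sum_selected[OF assms] of_nat_add of_nat_mult by simp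
  also have "\<dots> = fact n * (real (n + 1) * (real l / real (k + 1) + ?\<Pi>))"
    unfolding t_eq sum_t by (simp add: algebra_simps add_divide_distrib)
  finally have "real (\<Sum>a\<in>?P. selected n k l a)
      = fact n * (real (n + 1) / 2 * (real l / real (k + 1) + ?\<Pi>))"
    by simp
  moreover have "expected_selected n k l = real (\<Sum>a\<in>?P. selected n k l a) / fact n"
    unfolding expected_selected_def using integral_pmf_of_set[OF P fin] card by simp
  ultimately show ?thesis by simp
qed

section \<open>Asymptotics of the minimum\<close>

text \<open>The right side is the gap between \<open>w ^ (m + 1)\<close> and its tangent at 1. Its
  quadratic lower bound turns near-minimality into closeness of \<open>w\<close> to 1.\<close>

lemma power_tangent_ge:
  fixes w :: real
  assumes "0 \<le> w"
  shows "real m * (w - 1)\<^sup>2 \<le> w ^ (m + 1) - (real m + 1) * w + real m"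
proof (induction m)
  case (Suc m)
  \<comment> \<open>The gap for \<open>Suc m\<close> is \<open>w\<close> times the gap for
    \<open>m\<close>, plus \<open>(m + 1) * (w - 1) ^ 2\<close>.\<close>
  have "0 \<le> w * (w ^ (m + 1) - (real m + 1) * w + real m)"
    using Suc.IH assms by (intro mult_nonneg_nonneg) (auto intro: order_trans[rotated])
  then show ?case
    by (simp add: algebra_simps power2_eq_square)
qed simp

theorem mainTheorem2:
  fixes l :: nat and k :: "nat \<Rightarrow> nat"
  assumes "l \<ge> 1"
    and "\<And>n. n \<ge> l + 1 \<Longrightarrow>
           is_arg_min (\<lambda>m. expected_selected n m l) (\<lambda>m. l \<le> m \<and> m \<le> n - 1) (k n)"
  shows "((\<lambda>n. real (k n)) \<sim>[at_top] (\<lambda>n. real n powr (real l / real (l + 1)))) \<and>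
         ((\<lambda>n. expected_selected n (k n) l) \<sim>[at_top]
            (\<lambda>n. real (l + 1) / 2 * real n powr (1 / real (l + 1))))"
proof -
  define x where "x n = real n powr (real l / real (l + 1))" for n :: nat
  define F where "F n m = real l / real (m + 1) + (\<Prod>i<l. (real m - real i) / (real n - real i))"
    for n m :: nat
  \<comment> \<open>Subtracting \<open>l\<close> bounds every numerator \<open>k n - i\<close> of
    the product from below; \<open>e\<close> is chosen so that \<open>w n + e n\<close> is exactly
    \<open>(k n + 1) / x n\<close>.\<close>
  define w where "w n = (real (k n) - real l) / x n" for n
  define e where "e n = (real l + 1) / x n" for n
  have exp_pos: "0 < real l / real (l + 1)" and exp_less: "real l / real (l + 1) < 1"
    using assms(1) by auto
  have "filterlim (\<lambda>n. exp (real l / real (l + 1) * ln (real n))) at_top sequentially"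
    by (intro filterlim_compose[OF exp_at_top] filterlim_tendsto_pos_mult_at_top[OF tendsto_const exp_pos]
        filterlim_compose[OF ln_at_top filterlim_real_sequentially])
  moreover have "\<forall>\<^sub>F n in sequentially. exp (real l / real (l + 1) * ln (real n)) = x n"
    using eventually_gt_at_top[of 0] by eventually_elim (simp add: x_def powr_def)
  ultimately have x_top: "filterlim x at_top sequentially"
    by (rule filterlim_cong[OF refl refl, THEN iffD1, rotated])
  have x_pos: "0 < x n" if "0 < n" for n
    using that by (simp add: x_def)
  have x_pow: "x n ^ (l + 1) = real n ^ l" if "0 < n" for n
  proof -
    have "x n ^ (l + 1) = x n powr real (l + 1)"
      using x_pos[OF that] by (subst powr_realpow) auto
    also have "\<dots> = real n powr real l"
      unfolding x_def powr_powr by simp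
    finally show ?thesis using that by (simp add: powr_realpow)
  qed
  have k: "l \<le> k n" "k n < n" if "l + 1 \<le> n" for n
    using assms(2)[OF that] that by (auto simp: is_arg_min_def)
  have E_eq: "expected_selected n m l = real (n + 1) / 2 * F n m" if "l \<le> m" "m < n" for n m
    unfolding F_def using that assms(1) by (rule expected_selected_eq[rotated])
  have F_min: "F n (k n) \<le> F n m" if n: "l + 1 \<le> n" and m: "l \<le> m" "m < n" for n m
  proof -
    have "expected_selected n (k n) l \<le> expected_selected n m l"
      using assms(2)[OF n] m by (auto simp: is_arg_min_linorder)
    then show ?thesis
      using E_eq m k[OF n] n by simp
  qed
  have upper: "x n * F n (k n) \<le> real l + 1" if n: "l + 1 \<le> n" and xl: "real l \<le> x n" for n
  proof -
    have n0: "0 < n" using n by simp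
    define m where "m = nat \<lfloor>x n\<rfloor>"
    have m: "real m \<le> x n" "x n < real (m + 1)"
      using x_pos[OF n0] unfolding m_def by linarith+
    \<comment> \<open>An exponent below 1 gives \<open>x n < n\<close>; with
      \<open>l \<le> x n\<close> this makes the floor \<open>m\<close> an admissible competitor of
      \<open>k n\<close>.\<close>
    have "x n < real n powr 1"
      unfolding x_def using n assms(1) exp_less by (intro powr_less_mono) auto
    then have "real m < real n"
      using m(1) n0 by simp
    then have m': "l \<le> m" "m < n"
      using le_nat_floor[OF xl] by (simp_all add: m_def del: of_nat_nat)
    have "(\<Prod>i<l. (real m - real i) / (real n - real i)) \<le> (\<Prod>i<l. x n / real n)"
    proof (intro prod_mono conjI)
      fix i assume i: "i \<in> {..<l}"
      then show "0 \<le> (real m - real i) / (real n - real i)"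
        using m' by auto
      have "(real m - real i) / (real n - real i) \<le> real m / real n"
        using i m' by (simp add: field_simps mult_left_mono)
      also have "\<dots> \<le> x n / real n"
        using m by (intro divide_right_mono) auto
      finally show "(real m - real i) / (real n - real i) \<le> x n / real n" .
    qed
    also have "\<dots> = x n ^ l / real n ^ l"
      by (simp add: power_divide)
    finally have "F n m \<le> real l / x n + x n ^ l / real n ^ l"
      unfolding F_def using m x_pos[OF n0]
      by (intro add_mono divide_left_mono) auto
    with F_min[OF n m'] have "F n (k n) \<le> real l / x n + x n ^ l / real n ^ l"
      by simp
    then have "x n * F n (k n) \<le> x n * (real l / x n + x n ^ l / real n ^ l)"
      using x_pos[OF n0] by (intro mult_left_mono) auto
    also have "\<dots> = real l + x n ^ (l + 1) / real n ^ l"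
      using x_pos[OF n0] by (simp add: field_simps)
    also have "\<dots> = real l + 1"
      using x_pow[OF n0] n0 by simp
    finally show ?thesis .
  qed
  have lower: "real l / (w n + e n) + w n ^ l \<le> x n * F n (k n)" if n: "l + 1 \<le> n" for n
  proof -
    have n0: "0 < n" using n by simp
    have "((real (k n) - real l) / real n) ^ l = (\<Prod>i<l. (real (k n) - real l) / real n)"
      by simp
    \<comment> \<open>Each factor on the right has the larger numerator and the smaller
      denominator.\<close>
    also have "\<dots> \<le> (\<Prod>i<l. (real (k n) - real i) / (real n - real i))"
    proof (intro prod_mono conjI)
      fix i assume i: "i \<in> {..<l}"
      show "0 \<le> (real (k n) - real l) / real n"
        using k[OF n] by simp
      show "(real (k n) - real l) / real n \<le> (real (k n) - real i) / (real n - real i)"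
        using i k[OF n] n by (intro frac_le) auto
    qed
    finally have "real l / real (k n + 1) + ((real (k n) - real l) / real n) ^ l \<le> F n (k n)"
      by (simp add: F_def)
    then have "x n * (real l / real (k n + 1) + ((real (k n) - real l) / real n) ^ l)
        \<le> x n * F n (k n)"
      using x_pos[OF n0] by (intro mult_left_mono) auto
    moreover have "w n + e n = real (k n + 1) / x n"
      by (simp add: w_def e_def flip: add_divide_distrib)
    then have "x n * (real l / real (k n + 1)) = real l / (w n + e n)"
      by simp
    moreover have "x n * ((real (k n) - real l) / real n) ^ l = w n ^ l"
    proof -
      have "x n * ((real (k n) - real l) / real n) ^ l
          = x n * (real (k n) - real l) ^ l / x n ^ (l + 1)"
        using x_pow[OF n0] by (simp add: power_divide)
      also have "\<dots> = w n ^ l"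
        using x_pos[OF n0] by (simp add: w_def power_divide)
      finally show ?thesis .
    qed
    ultimately show ?thesis by (simp add: distrib_left)
  qed
  have ev: "\<forall>\<^sub>F n in sequentially. l + 1 \<le> n \<and> real l \<le> x n"
    using eventually_ge_at_top[of "l + 1"] filterlim_at_top[THEN iffD1, OF x_top, rule_format, of "real l"]
    by eventually_elim simp
  have div_x: "(\<lambda>n. c / x n) \<longlonglongrightarrow> 0" for c
    by (rule real_tendsto_divide_at_top[OF tendsto_const x_top])
  have e_lim: "e \<longlonglongrightarrow> 0"
    unfolding e_def by (rule div_x)
  have w_close: "(w n - 1)\<^sup>2 \<le> (real l + 1) * e n"
    if n: "l + 1 \<le> n" and xl: "real l \<le> x n" for n
  proof -
    have "0 < x n" using n by (intro x_pos) simp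
    then have w0: "0 \<le> w n" and e0: "0 < e n"
      using k[OF n] by (auto simp: w_def e_def)
    have "real l / (w n + e n) + w n ^ l \<le> real l + 1"
      using lower[OF n] upper[OF n xl] by simp
    \<comment> \<open>Clearing the denominator and then dropping the nonnegative term
      \<open>w n ^ l * e n\<close> leaves the tangent gap of \<open>power_tangent_ge\<close>,
      bounded by a multiple of \<open>e n\<close>.\<close>
    then have "(real l / (w n + e n) + w n ^ l) * (w n + e n) \<le> (real l + 1) * (w n + e n)"
      using w0 e0 by (intro mult_right_mono) auto
    moreover have "(real l / (w n + e n) + w n ^ l) * (w n + e n)
        = real l + w n ^ (l + 1) + w n ^ l * e n"
    proof -
      have "real l / (w n + e n) * (w n + e n) = real l"
        using w0 e0 by simp
      then show ?thesis
        by (simp only: distrib_right) (simp add: distrib_left mult.commute)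
    qed
    ultimately have "real l + w n ^ (l + 1) + w n ^ l * e n \<le> (real l + 1) * (w n + e n)"
      by simp
    moreover have "0 \<le> w n ^ l * e n"
      using w0 e0 by simp
    ultimately have "w n ^ (l + 1) - (real l + 1) * w n + real l \<le> (real l + 1) * e n"
      by (simp add: distrib_left)
    then have "real l * (w n - 1)\<^sup>2 \<le> (real l + 1) * e n"
      using power_tangent_ge[OF w0, of l] by linarith
    moreover have "1 * (w n - 1)\<^sup>2 \<le> real l * (w n - 1)\<^sup>2"
      using assms(1) by (intro mult_right_mono) auto
    ultimately show ?thesis by simp
  qed
  have "(\<lambda>n. (w n - 1)\<^sup>2) \<longlonglongrightarrow> 0"
  proof (rule tendsto_sandwich[of "\<lambda>_. 0"])
    show "\<forall>\<^sub>F n in sequentially. (w n - 1)\<^sup>2 \<le> (real l + 1) * e n"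
      using ev by eventually_elim (simp add: w_close)
    show "(\<lambda>n. (real l + 1) * e n) \<longlonglongrightarrow> 0"
      using tendsto_mult_right_zero[OF e_lim] .
  qed auto
  then have w_lim: "w \<longlonglongrightarrow> 1"
    by (simp add: LIM_zero_cancel)
  \<comment> \<open>This sum is \<open>k n / x n\<close>; the shift by \<open>l\<close> in
    \<open>w\<close> vanishes in the limit.\<close>
  have "(\<lambda>n. w n + real l / x n) \<longlonglongrightarrow> 1"
    using tendsto_add[OF w_lim div_x[of "real l"]] by simp
  then have "(\<lambda>n. real (k n) / x n) \<longlonglongrightarrow> 1"
    by (simp add: w_def flip: add_divide_distrib)
  then have "(\<lambda>n. real (k n)) \<sim>[at_top] x"
    by (intro asymp_equivI')
  moreover have "(\<lambda>n. expected_selected n (k n) l) \<sim>[at_top]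
      (\<lambda>n. real (l + 1) / 2 * real n powr (1 / real (l + 1)))"
  proof (rule asymp_equivI')
    \<comment> \<open>The lower bound tends to \<open>l + 1\<close> since \<open>w\<close> tends to
      1 and \<open>e\<close> to 0; the upper bound is already the constant
      \<open>l + 1\<close>.\<close>
    have xF_lim: "(\<lambda>n. x n * F n (k n)) \<longlonglongrightarrow> real l + 1"
    proof (rule tendsto_sandwich)
      show "\<forall>\<^sub>F n in sequentially. real l / (w n + e n) + w n ^ l \<le> x n * F n (k n)"
        using ev by eventually_elim (simp add: lower)
      show "\<forall>\<^sub>F n in sequentially. x n * F n (k n) \<le> real l + 1"
        using ev by eventually_elim (simp add: upper)
      have "(\<lambda>n. real l / (w n + e n) + w n ^ l) \<longlonglongrightarrow> real l / (1 + 0) + 1 ^ l"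
        by (intro tendsto_intros w_lim e_lim) simp
      then show "(\<lambda>n. real l / (w n + e n) + w n ^ l) \<longlonglongrightarrow> real l + 1"
        by simp
    qed simp
    \<comment> \<open>The factor \<open>1 + 1 / n\<close> is what remains of \<open>n + 1\<close>
      after division by \<open>n powr (1 / (l + 1)) = n / x n\<close>.\<close>
    have "(\<lambda>n. (1 + 1 / real n) * (x n * F n (k n) / (real l + 1)))
        \<longlonglongrightarrow> (1 + 0) * ((real l + 1) / (real l + 1))"
      by (intro tendsto_intros xF_lim lim_1_over_n) simp
    then have "(\<lambda>n. (1 + 1 / real n) * (x n * F n (k n) / (real l + 1))) \<longlonglongrightarrow> 1"
      by simp
    moreover have "\<forall>\<^sub>F n in sequentially. (1 + 1 / real n) * (x n * F n (k n) / (real l + 1))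
        = expected_selected n (k n) l / (real (l + 1) / 2 * real n powr (1 / real (l + 1)))"
      using ev
    proof eventually_elim
      case (elim n)
      then have n: "l + 1 \<le> n" and n0: "0 < n" by auto
      have "real l / real (l + 1) + 1 / real (l + 1) = 1"
        by (simp add: field_simps)
      then have "x n * real n powr (1 / real (l + 1)) = real n powr 1"
        unfolding x_def powr_add[symmetric] by simp
      then have root: "real n powr (1 / real (l + 1)) = real n / x n"
        using x_pos[OF n0] by (simp add: field_simps)
      show ?case
        unfolding root using x_pos[OF n0] n0 E_eq[OF k[OF n]] by (simp add: field_simps)
    qed
    ultimately show "(\<lambda>n. expected_selected n (k n) l
        / (real (l + 1) / 2 * real n powr (1 / real (l + 1)))) \<longlonglongrightarrow> 1"
      by (rule Lim_transform_eventually)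
  qed
  ultimately show ?thesis
    unfolding x_def by simp
qed

end
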